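(* There is an algorithm that, given an instance of the line planning on all lines problem (LPAL) with $d_{\mathrm{fix}}=0$ whose graph $G$ is a star with $n$ vertices, computes an optimal (minimum-cost feasible) line concept in $\mathcal{O}(n^3)$ time.
   Context: A star is a complete bipartite graph $K_{1,k}$. A line planning instance is a tuple $(G,d_{\mathrm{fix}},c_{\mathrm{fix}},c,f^{\min},f^{\max})$ where $G=(V,E)$ is a finite simple graph with $n=|V|$, $d_{\mathrm{fix}}\ge 0$ and $c_{\mathrm{fix}}\ge 0$ are reals, $c:E\to\mathbb{R}_{\ge 0}$ gives edge costs $c_e$, and $f^{\min},f^{\max}$ assign to each edge integer bounds $f^{\min}_e\le f^{\max}_e$ ($f^{\max}_e=\infty$ allowed). A line is a simple path in $G$; a line concept $(\mathcal{L},f)$ is a set $\mathcal{L}$ of lines with frequencies $f_\ell\in\mathbb{N}$. It is feasible if for every edge $e$, $f^{\min}_e\le\sum_{\ell\in\mathcal{L}:e\in E(\ell)}f_\ell\le f^{\max}_e$. Its cost is $d_{\mathrm{fix}}|\mathcal{L}|+\sum_{\ell\in\mathcal{L}}f_\ell\,(c_{\mathrm{fix}}+\sum_{e\in E(\ell)}c_e)$. LPAL asks for a feasible line concept of minimum cost. *)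

theory Defs
  imports Complex_Main "HOL-Library.Landau_Symbols"
begin

section \<open>Line planning on all lines\<close>

text \<open>
  The upper frequency bound \<open>None\<close> stands for \<open>\<infinity>\<close>. The functions
  on edges are only relevant on \<open>edges I\<close>.
\<close>

record 'v lp_instance =
  verts :: "'v set"
  edges :: "'v set set"
  d_fix :: real
  c_fix :: real
  edge_cost :: "'v set \<Rightarrow> real"
  f_min :: "'v set \<Rightarrow> int"
  f_max :: "'v set \<Rightarrow> int option"

definition simple_graph :: "'v set \<Rightarrow> 'v set set \<Rightarrow> bool" where
  "simple_graph V E \<longleftrightarrow> finite V \<and> (\<forall>e\<in>E. e \<subseteq> V \<and> card e = 2)"

definition le_upper :: "int \<Rightarrow> int option \<Rightarrow> bool" where
  "le_upper k b \<longleftrightarrow> (case b of None \<Rightarrow> True | Some u \<Rightarrow> k \<le> u)"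

definition valid_instance :: "'v lp_instance \<Rightarrow> bool" where
  "valid_instance I \<longleftrightarrow>
     simple_graph (verts I) (edges I) \<and> 0 \<le> d_fix I \<and> 0 \<le> c_fix I \<and>
     (\<forall>e\<in>edges I. 0 \<le> edge_cost I e \<and> le_upper (f_min I e) (f_max I e))"

definition complete_bipartite :: "nat \<Rightarrow> nat \<Rightarrow> 'v set \<Rightarrow> 'v set set \<Rightarrow> bool" where
  "complete_bipartite p q V E \<longleftrightarrow>
     (\<exists>A B. finite A \<and> finite B \<and> card A = p \<and> card B = q \<and> A \<inter> B = {} \<and>
            V = A \<union> B \<and> E = {{a, b} |a b. a \<in> A \<and> b \<in> B})"

definition is_star :: "'v set \<Rightarrow> 'v set set \<Rightarrow> bool" where
  "is_star V E \<longleftrightarrow> (\<exists>k. complete_bipartite 1 k V E)"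

text \<open>
  A path is a subgraph, given by its vertex set and its edge set, so that a vertex
  sequence and its reversal are the same line.
\<close>

type_synonym 'v line = "'v set \<times> 'v set set"

fun path_edges :: "'v list \<Rightarrow> 'v set set" where
  "path_edges (x # y # xs) = insert {x, y} (path_edges (y # xs))"
| "path_edges _ = {}"

definition line_of :: "'v list \<Rightarrow> 'v line" where
  "line_of xs = (set xs, path_edges xs)"

definition is_line :: "'v lp_instance \<Rightarrow> 'v line \<Rightarrow> bool" where
  "is_line I l \<longleftrightarrow>
     (\<exists>xs. xs \<noteq> [] \<and> distinct xs \<and> set xs \<subseteq> verts I \<and> path_edges xs \<subseteq> edges I \<and> l = line_of xs)"

abbreviation line_edges :: "'v line \<Rightarrow> 'v set set" where
  "line_edges \<equiv> snd"

type_synonym 'v line_concept = "'v line set \<times> ('v line \<Rightarrow> nat)"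

definition edge_frequency :: "'v line_concept \<Rightarrow> 'v set \<Rightarrow> nat" where
  "edge_frequency \<C> e = (case \<C> of (\<L>, f) \<Rightarrow> \<Sum>l\<in>{l\<in>\<L>. e \<in> line_edges l}. f l)"

definition feasible :: "'v lp_instance \<Rightarrow> 'v line_concept \<Rightarrow> bool" where
  "feasible I \<C> \<longleftrightarrow>
     (\<forall>l\<in>fst \<C>. is_line I l) \<and>
     (\<forall>e\<in>edges I. f_min I e \<le> int (edge_frequency \<C> e) \<and>
                  le_upper (int (edge_frequency \<C> e)) (f_max I e))"

definition concept_cost :: "'v lp_instance \<Rightarrow> 'v line_concept \<Rightarrow> real" where
  "concept_cost I \<C> = (case \<C> of (\<L>, f) \<Rightarrow>
     d_fix I * real (card \<L>) +
     (\<Sum>l\<in>\<L>. real (f l) * (c_fix I + (\<Sum>e\<in>line_edges l. edge_cost I e))))"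

definition optimal :: "'v lp_instance \<Rightarrow> 'v line_concept \<Rightarrow> bool" where
  "optimal I \<C> \<longleftrightarrow>
     feasible I \<C> \<and> (\<forall>\<C>'. feasible I \<C>' \<longrightarrow> concept_cost I \<C> \<le> concept_cost I \<C>')"


section \<open>Model of computation\<close>

text \<open>
  A unit-cost random access machine programmed in a while language. The memory consists
  of named integer and real cells and named integer and real arrays with random access;
  a program mentions only finitely many names. Every operator occurring in an
  expression and every elementary command takes one time step. Integer multiplication is
  deliberately not a primitive, and there is no conversion from reals to integers, which
  keeps the unit-cost assumption from being exploited by computing with huge integers. Program
  constants are integers only, so a program cannot carry infinitely many bits of advice.
\<close>

type_synonym vname = string

record state =
  ivar :: "vname \<Rightarrow> int"
  iarr :: "vname \<Rightarrow> int \<Rightarrow> int"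
  rvar :: "vname \<Rightarrow> real"
  rarr :: "vname \<Rightarrow> int \<Rightarrow> real"

datatype iexp =
    IConst int
  | IVar vname
  | IArr vname iexp
  | IAdd iexp iexp
  | ISub iexp iexp
  | IHalf iexp

datatype rexp =
    RVar vname
  | RArr vname iexp
  | ROfInt iexp
  | RAdd rexp rexp
  | RSub rexp rexp
  | RMul rexp rexp
  | RDiv rexp rexp

datatype bexp =
    ILess iexp iexp
  | RLess rexp rexp
  | BNot bexp
  | BAnd bexp bexp

datatype com =
    Skip
  | IAssign vname iexp
  | IStore vname iexp iexp
  | RAssign vname rexp
  | RStore vname iexp rexp
  | Seq com com
  | If bexp com com
  | While bexp com

fun ival :: "iexp \<Rightarrow> state \<Rightarrow> int" where
  "ival (IConst k) s = k"
| "ival (IVar x) s = ivar s x"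
| "ival (IArr a e) s = iarr s a (ival e s)"
| "ival (IAdd e1 e2) s = ival e1 s + ival e2 s"
| "ival (ISub e1 e2) s = ival e1 s - ival e2 s"
| "ival (IHalf e) s = ival e s div 2"

fun rval :: "rexp \<Rightarrow> state \<Rightarrow> real" where
  "rval (RVar x) s = rvar s x"
| "rval (RArr a e) s = rarr s a (ival e s)"
| "rval (ROfInt e) s = real_of_int (ival e s)"
| "rval (RAdd e1 e2) s = rval e1 s + rval e2 s"
| "rval (RSub e1 e2) s = rval e1 s - rval e2 s"
| "rval (RMul e1 e2) s = rval e1 s * rval e2 s"
| "rval (RDiv e1 e2) s = rval e1 s / rval e2 s"

fun bval :: "bexp \<Rightarrow> state \<Rightarrow> bool" where
  "bval (ILess e1 e2) s \<longleftrightarrow> ival e1 s < ival e2 s"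
| "bval (RLess e1 e2) s \<longleftrightarrow> rval e1 s < rval e2 s"
| "bval (BNot b) s \<longleftrightarrow> \<not> bval b s"
| "bval (BAnd b1 b2) s \<longleftrightarrow> bval b1 s \<and> bval b2 s"

fun itime :: "iexp \<Rightarrow> nat" where
  "itime (IConst k) = 1"
| "itime (IVar x) = 1"
| "itime (IArr a e) = 1 + itime e"
| "itime (IAdd e1 e2) = 1 + itime e1 + itime e2"
| "itime (ISub e1 e2) = 1 + itime e1 + itime e2"
| "itime (IHalf e) = 1 + itime e"

fun rtime :: "rexp \<Rightarrow> nat" where
  "rtime (RVar x) = 1"
| "rtime (RArr a e) = 1 + itime e"
| "rtime (ROfInt e) = 1 + itime e"
| "rtime (RAdd e1 e2) = 1 + rtime e1 + rtime e2"
| "rtime (RSub e1 e2) = 1 + rtime e1 + rtime e2"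
| "rtime (RMul e1 e2) = 1 + rtime e1 + rtime e2"
| "rtime (RDiv e1 e2) = 1 + rtime e1 + rtime e2"

fun btime :: "bexp \<Rightarrow> nat" where
  "btime (ILess e1 e2) = 1 + itime e1 + itime e2"
| "btime (RLess e1 e2) = 1 + rtime e1 + rtime e2"
| "btime (BNot b) = 1 + btime b"
| "btime (BAnd b1 b2) = 1 + btime b1 + btime b2"

text \<open>
  \<open>exec c s t s'\<close>: started in \<open>s\<close>, the program \<open>c\<close> halts after exactly \<open>t\<close> time steps in
  \<open>s'\<close>. A nonterminating computation has no derivation.
\<close>

inductive exec :: "com \<Rightarrow> state \<Rightarrow> nat \<Rightarrow> state \<Rightarrow> bool" where
  Skip: "exec Skip s 1 s"
| IAssign: "exec (IAssign x e) s (1 + itime e)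
    (s\<lparr>ivar := (ivar s)(x := ival e s)\<rparr>)"
| IStore: "exec (IStore a i e) s (1 + itime i + itime e)
    (s\<lparr>iarr := (iarr s)(a := (iarr s a)(ival i s := ival e s))\<rparr>)"
| RAssign: "exec (RAssign x r) s (1 + rtime r)
    (s\<lparr>rvar := (rvar s)(x := rval r s)\<rparr>)"
| RStore: "exec (RStore a i r) s (1 + itime i + rtime r)
    (s\<lparr>rarr := (rarr s)(a := (rarr s a)(ival i s := rval r s))\<rparr>)"
| Seq: "exec c1 s t1 s1 \<Longrightarrow> exec c2 s1 t2 s2 \<Longrightarrow> exec (Seq c1 c2) s (t1 + t2) s2"
| IfTrue: "bval b s \<Longrightarrow> exec c1 s t s' \<Longrightarrow> exec (If b c1 c2) s (1 + btime b + t) s'"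
| IfFalse: "\<not> bval b s \<Longrightarrow> exec c2 s t s' \<Longrightarrow> exec (If b c1 c2) s (1 + btime b + t) s'"
| WhileFalse: "\<not> bval b s \<Longrightarrow> exec (While b c) s (1 + btime b) s"
| WhileTrue: "bval b s \<Longrightarrow> exec c s t1 s1 \<Longrightarrow> exec (While b c) s1 t2 s2 \<Longrightarrow>
    exec (While b c) s (1 + btime b + t1 + t2) s2"

inductive_cases exec_elims:
  "exec Skip s t s'"
  "exec (IAssign x e) s t s'"
  "exec (IStore a i e) s t s'"
  "exec (RAssign x r) s t s'"
  "exec (RStore a i r) s t s'"
  "exec (Seq c1 c2) s t s'"
  "exec (If b c1 c2) s t s'"
  "exec (While b c) s t s'"

lemma exec_deterministic:
  "exec c s t s' \<Longrightarrow> exec c s u s'' \<Longrightarrow> t = u \<and> s' = s''"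
proof (induction arbitrary: u s'' rule: exec.induct)
  case (Seq c1 s t1 s1 c2 t2 s2)
  from Seq.prems obtain u1 r u2 where "exec c1 s u1 r" "exec c2 r u2 s''" "u = u1 + u2"
    by (rule exec_elims(6))
  with Seq.IH show ?case by metis
next
  case (IfTrue b s c1 t s' c2)
  from IfTrue.prems IfTrue.hyps obtain v where "exec c1 s v s''" "u = 1 + btime b + v"
    by - (erule exec_elims(7); simp)
  with IfTrue.IH show ?case by metis
next
  case (IfFalse b s c2 t s' c1)
  from IfFalse.prems IfFalse.hyps obtain v where "exec c2 s v s''" "u = 1 + btime b + v"
    by - (erule exec_elims(7); simp)
  with IfFalse.IH show ?case by metis
next
  case (WhileFalse b s c)
  from WhileFalse.prems WhileFalse.hyps show ?case by - (erule exec_elims(8); simp)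
next
  case (WhileTrue b s c t1 s1 t2 s2)
  from WhileTrue.prems WhileTrue.hyps obtain u1 r u2
    where "exec c s u1 r" "exec (While b c) r u2 s''" "u = 1 + btime b + u1 + u2"
    by - (erule exec_elims(8); simp)
  with WhileTrue.IH show ?case by metis
qed (erule exec_elims; simp)+


section \<open>Input and output of algorithms for line planning\<close>

text \<open>
  The vertices are numbered \<open>0, \<dots>, n - 1\<close>. The edges are listed in an arbitrary order and
  each with its endpoints in an arbitrary order. All memory not mentioned may
  initially hold arbitrary values.
\<close>

definition encodes_instance :: "state \<Rightarrow> nat lp_instance \<Rightarrow> bool" where
  "encodes_instance s I \<longleftrightarrow>
     verts I = {..<card (verts I)} \<and>
     ivar s ''n'' = int (card (verts I)) \<and>
     ivar s ''m'' = int (card (edges I)) \<and>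
     rvar s ''d_fix'' = d_fix I \<and>
     rvar s ''c_fix'' = c_fix I \<and>
     (\<exists>es :: (nat \<times> nat) list.
        distinct (map (\<lambda>(a, b). {a, b}) es) \<and>
        edges I = (\<lambda>(a, b). {a, b}) ` set es \<and>
        (\<forall>j<length es. \<forall>a b e. es ! j = (a, b) \<and> e = {a, b} \<longrightarrow>
           iarr s ''edge_fst'' (int j) = int a \<and>
           iarr s ''edge_snd'' (int j) = int b \<and>
           rarr s ''cost'' (int j) = edge_cost I e \<and>
           iarr s ''f_min'' (int j) = f_min I e \<and>
           (case f_max I e of
              None \<Rightarrow> iarr s ''f_max_infinite'' (int j) = 1
            | Some u \<Rightarrow> iarr s ''f_max_infinite'' (int j) = 0 \<and>
                        iarr s ''f_max'' (int j) = u)))"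

text \<open>
  A line concept is output as a list of pairwise different lines with their frequencies.
  The vertex sequence of line number \<open>i\<close> is the segment of the array \<open>path\<close> from
  position \<open>offset[i]\<close> up to but excluding position \<open>offset[i + 1]\<close>.
\<close>

definition encodes_concept :: "state \<Rightarrow> nat line_concept \<Rightarrow> bool" where
  "encodes_concept s \<C> \<longleftrightarrow>
     (\<exists>ps :: nat list list.
        ivar s ''num_lines'' = int (length ps) \<and>
        (\<forall>xs\<in>set ps. distinct xs) \<and>
        distinct (map line_of ps) \<and>
        fst \<C> = line_of ` set ps \<and>
        (\<forall>i<length ps.
           iarr s ''frequency'' (int i) = int (snd \<C> (line_of (ps ! i))) \<and>
           iarr s ''offset'' (int i + 1) = iarr s ''offset'' (int i) + int (length (ps ! i)) \<and>
           (\<forall>k<length (ps ! i).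
              iarr s ''path'' (iarr s ''offset'' (int i) + int k) = int (ps ! i ! k))))"

definition output_correct :: "nat lp_instance \<Rightarrow> state \<Rightarrow> bool" where
  "output_correct I s \<longleftrightarrow>
     (if \<exists>\<C>. feasible I \<C>
      then ivar s ''feasible'' = 1 \<and> (\<exists>\<C>. encodes_concept s \<C> \<and> optimal I \<C>)
      else ivar s ''feasible'' = 0)"

definition solves_within :: "com \<Rightarrow> nat lp_instance \<Rightarrow> nat \<Rightarrow> bool" where
  "solves_within P I b \<longleftrightarrow>
     (\<forall>s. encodes_instance s I \<longrightarrow> (\<exists>t s'. exec P s t s' \<and> t \<le> b \<and> output_correct I s'))"

end

theory Submission
  imports Defs
begin

text \<open>
  A line in a star has at most two edges. With \<open>d_fix = 0\<close> the cost of a concept is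
  \<open>c_fix\<close> times the total frequency plus the sum of the edge costs weighted by the edge frequencies,
  so it is best to give every edge \<open>e\<close> exactly the frequency \<open>l e = max 0 (f_min e)\<close>. The total
  frequency is then at least \<open>N = max \<lceil>S / 2\<rceil> (Max l)\<close> with \<open>S = sum l\<close>. This bound is attained by
  McNaughton's wrap-around rule: lay out the edges as consecutive intervals of lengths \<open>l e\<close> on
  \<open>[0, S)\<close> and combine position \<open>p\<close> with position \<open>p + N\<close> into one line. As \<open>l e \<le> N\<close>, no edge is
  combined with itself, and the frequency of each pair of edges is the length of the overlap of an
  interval with an interval shifted by \<open>N\<close>.
\<close>

subsection \<open>The wrap-around rule\<close>

text \<open>The number of integers in the intersection of [a, b) and [c, d); clipping at 0 also
  covers empty intervals.\<close>

definition overlap :: "int \<Rightarrow> int \<Rightarrow> int \<Rightarrow> int \<Rightarrow> int" where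
  "overlap a b c d = max 0 (min b d - max a c)"

lemma overlap_nonneg: "0 \<le> overlap a b c d"
  by (simp add: overlap_def)

lemma overlap_commute: "overlap a b c d = overlap c d a b"
  by (simp add: overlap_def min.commute max.commute)

lemma overlap_split: "c \<le> d \<Longrightarrow> d \<le> e \<Longrightarrow> overlap a b c d + overlap a b d e = overlap a b c e"
  by (auto simp: overlap_def max_def min_def)

lemma overlap_empty: "b \<le> c \<Longrightarrow> overlap a b c d = 0" "d \<le> a \<Longrightarrow> overlap a b c d = 0"
  by (auto simp: overlap_def max_def min_def)

text \<open>Consecutive intervals [Q i, Q (Suc i)) tile [Q 0, Q m), so their overlaps with [a, b)
  add up.\<close>

lemma sum_overlap:
  assumes "mono Q"
  shows "(\<Sum>i<m. overlap a b (Q i) (Q (Suc i))) = overlap a b (Q 0) (Q m)"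
proof (induction m)
  case 0
  then show ?case by (simp add: overlap_def)
next
  case (Suc m)
  have "Q 0 \<le> Q m" "Q m \<le> Q (Suc m)"
    using assms by (auto simp: mono_def)
  with Suc show ?case by (simp add: overlap_split)
qed

text \<open>Inclusion-exclusion: row \<open>k\<close> and column \<open>k\<close> meet in the single
  cell (k, k).\<close>

lemma sum_square_cross:
  fixes w :: "nat \<Rightarrow> nat \<Rightarrow> int"
  assumes "k < m"
  shows "(\<Sum>i<m. \<Sum>j<m. if k = i \<or> k = j then w i j else 0)
    = (\<Sum>j<m. w k j) + (\<Sum>i<m. w i k) - w k k"
proof -
  have "(\<Sum>i<m. \<Sum>j<m. if k = i \<or> k = j then w i j else 0)
     = (\<Sum>i<m. \<Sum>j<m. (if k = i then w i j else 0) + (if k = j then w i j else 0)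
           - (if k = i then if k = j then w i j else 0 else 0))"
    by (intro sum.cong) auto
  also have "\<dots> = (\<Sum>i<m. \<Sum>j<m. if k = i then w i j else 0) + (\<Sum>i<m. \<Sum>j<m. if k = j then w i j else 0)
     - (\<Sum>i<m. \<Sum>j<m. if k = i then if k = j then w i j else 0 else 0)"
    by (simp only: sum.distrib sum_subtractf)
  also have "(\<Sum>i<m. \<Sum>j<m. if k = i then w i j else 0) = (\<Sum>i<m. if k = i then \<Sum>j<m. w i j else 0)"
    by (intro sum.cong) auto
  also have "(\<Sum>i<m. \<Sum>j<m. if k = i then if k = j then w i j else 0 else 0)
      = (\<Sum>i<m. if k = i then w i k else 0)"
    using assms by (intro sum.cong) auto
  finally show ?thesis using assms by simp
qed

definition prefix_sum :: "(nat \<Rightarrow> int) \<Rightarrow> nat \<Rightarrow> int" where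
  "prefix_sum l k = (\<Sum>j<k. l j)"

text \<open>Below the diagonal, this counts positions p of item \<open>j\<close> whose partner p + N
  lies in item \<open>i\<close>. The diagonal counts positions of item \<open>i\<close> in [S - N,
  N) with S = \<open>prefix_sum l m\<close>, where neither p + N nor p - N lies in [0, S).\<close>

definition wrap_freq :: "(nat \<Rightarrow> int) \<Rightarrow> nat \<Rightarrow> int \<Rightarrow> nat \<Rightarrow> nat \<Rightarrow> int" where
  "wrap_freq l m N i j =
     (if j < i then overlap (prefix_sum l j) (prefix_sum l (Suc j))
                            (prefix_sum l i - N) (prefix_sum l (Suc i) - N)
      else overlap (prefix_sum l i) (prefix_sum l (Suc i)) (prefix_sum l m - N) N)"

definition index_pairs :: "nat \<Rightarrow> (nat \<times> nat) set" where
  "index_pairs m = {(i, j). i < m \<and> j \<le> i}"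

lemma finite_index_pairs [simp]: "finite (index_pairs m)"
  by (rule finite_subset[of _ "{..<m} \<times> {..<m}"]) (auto simp: index_pairs_def)

lemma sum_index_pairs:
  "(\<Sum>(i, j)\<in>index_pairs m. h i j) = (\<Sum>i<m. \<Sum>j<m. if j \<le> i then h i j else 0)"
  for h :: "nat \<Rightarrow> nat \<Rightarrow> int"
proof -
  have "(\<Sum>i<m. \<Sum>j<m. if j \<le> i then h i j else 0)
     = (\<Sum>(i, j)\<in>{..<m} \<times> {..<m}. if j \<le> i then h i j else 0)"
    by (simp add: sum.cartesian_product)
  also have "\<dots> = (\<Sum>(i, j)\<in>index_pairs m. h i j)"
    by (rule sum.mono_neutral_cong_right) (auto simp: index_pairs_def split: if_splits)
  finally show ?thesis by simp
qed

text \<open>By N <= S <= 2 * N, the interval [0, S) splits into [0, S - N), [S - N, N) and [N, S).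
  Shifting by N matches the first part with the last, and the middle part stays alone.\<close>

locale wrap_around =
  fixes l :: "nat \<Rightarrow> int" and m :: nat and N :: int
  assumes nonneg: "\<And>j. j < m \<Longrightarrow> 0 \<le> l j"
    and le_N: "\<And>j. j < m \<Longrightarrow> l j \<le> N"
    and N_le: "N \<le> prefix_sum l m"
    and le_2N: "prefix_sum l m \<le> 2 * N"
begin

abbreviation (input) "P \<equiv> prefix_sum l"

lemma prefix_sum_mono: "i \<le> j \<Longrightarrow> j \<le> m \<Longrightarrow> P i \<le> P j"
  unfolding prefix_sum_def by (rule sum_mono2) (auto intro: nonneg)

lemma prefix_sum_nonneg: "j \<le> m \<Longrightarrow> 0 \<le> P j"
  using prefix_sum_mono[of 0 j] by (simp add: prefix_sum_def)

lemma N_nonneg: "0 \<le> N"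
  using N_le le_2N by linarith

definition pair_overlap :: "nat \<Rightarrow> nat \<Rightarrow> int" where
  "pair_overlap i j = overlap (P j) (P (Suc j)) (P i - N) (P (Suc i) - N)"

text \<open>An item is never paired with itself, since it is no longer than \<open>N\<close>.\<close>

lemma pair_overlap_eq_0:
  assumes "i < m" "j < m" "i \<le> j"
  shows "pair_overlap i j = 0"
proof -
  have "P (Suc i) - N \<le> P i" using le_N[OF assms(1)] by (simp add: prefix_sum_def)
  also have "\<dots> \<le> P j" using assms by (intro prefix_sum_mono) auto
  finally show ?thesis unfolding pair_overlap_def by (rule overlap_empty(2))
qed

lemma sum_overlap_prefix_sum:
  "(\<Sum>i<m. overlap a b (P i - c) (P (Suc i) - c)) = overlap a b (- c) (P m - c)"
proof -
  \<comment> \<open>\<open>l\<close> is nonnegative only below \<open>m\<close>; freezing the index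
    at \<open>m\<close> makes \<open>Q\<close> monotone on all naturals, as
    \<open>sum_overlap\<close> demands.\<close>
  define Q where "Q i = P (min i m) - c" for i
  have "mono Q"
    by (auto simp: mono_def Q_def intro!: prefix_sum_mono)
  from sum_overlap[OF this, where m=m and a=a and b=b]
  show ?thesis by (simp add: Q_def prefix_sum_def min_def)
qed

lemma sum_pair_overlap_upper:
  assumes "k < m"
  shows "(\<Sum>j<m. pair_overlap k j) = overlap (P k) (P (Suc k)) N (P m)"
proof -
  have "(\<Sum>j<m. pair_overlap k j) = overlap (P k - N) (P (Suc k) - N) 0 (P m)"
    unfolding pair_overlap_def using sum_overlap_prefix_sum[where c=0]
    by (simp add: overlap_commute[of "P _" "P (Suc _)"])
  \<comment> \<open>Both intervals are shifted by N. The right end stays inactive because P (Suc k)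
    <= P m and 0 <= N.\<close>
  also have "\<dots> = overlap (P k) (P (Suc k)) N (P m)"
    using prefix_sum_mono[of k m] prefix_sum_mono[of "Suc k" m] N_nonneg assms
    by (auto simp: overlap_def max_def min_def)
  finally show ?thesis .
qed

lemma sum_pair_overlap_lower:
  assumes "k < m"
  shows "(\<Sum>i<m. pair_overlap i k) = overlap (P k) (P (Suc k)) 0 (P m - N)"
proof -
  have "(\<Sum>i<m. pair_overlap i k) = overlap (P k) (P (Suc k)) (- N) (P m - N)"
    unfolding pair_overlap_def by (rule sum_overlap_prefix_sum)
  \<comment> \<open>Items start at nonnegative positions, so the left end -N may be raised to
    0.\<close>
  then show ?thesis
    using prefix_sum_nonneg[of k] prefix_sum_nonneg[of "Suc k"] N_nonneg assms
    by (auto simp: overlap_def max_def min_def)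
qed

definition unpaired :: "nat \<Rightarrow> int" where
  "unpaired i = overlap (P i) (P (Suc i)) (P m - N) N"

text \<open>\<open>pair_overlap\<close> vanishes for i <= j, so the triangular table extends to the
  whole square, where rows and columns can be summed separately.\<close>

lemma wrap_freq_eq:
  "i < m \<Longrightarrow> j < m \<Longrightarrow>
    (if j \<le> i then wrap_freq l m N i j else 0) = pair_overlap i j + (if i = j then unpaired i else 0)"
  using pair_overlap_eq_0[of i j]
  by (auto simp: wrap_freq_def pair_overlap_def unpaired_def)

text \<open>The points S - N and N cut item \<open>k\<close> into positions with a partner above,
  with none, and with a partner below; the three counts add up to its length.\<close>

lemma wrap_freq_degree:
  assumes "k < m"
  shows "(\<Sum>(i, j)\<in>index_pairs m. if k = i \<or> k = j then wrap_freq l m N i j else 0) = l k"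
proof -
  have "(\<Sum>(i, j)\<in>index_pairs m. if k = i \<or> k = j then wrap_freq l m N i j else 0)
    = (\<Sum>i<m. \<Sum>j<m. if k = i \<or> k = j then pair_overlap i j + (if i = j then unpaired i else 0) else 0)"
    unfolding sum_index_pairs by (intro sum.cong refl) (auto simp flip: wrap_freq_eq)
  \<comment> \<open>Row and column \<open>k\<close> each contain \<open>unpaired k\<close>; the
    subtracted diagonal entry removes one copy, as \<open>pair_overlap k k\<close> is 0.\<close>
  also have "\<dots> = (\<Sum>j<m. pair_overlap k j) + (\<Sum>i<m. pair_overlap i k) + unpaired k"
    using assms unfolding sum_square_cross[OF assms]
    by (simp add: sum.distrib pair_overlap_eq_0)
  also have "\<dots> = overlap (P k) (P (Suc k)) 0 (P m - N) + unpaired k + overlap (P k) (P (Suc k)) N (P m)"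
    using assms by (simp add: sum_pair_overlap_upper sum_pair_overlap_lower)
  also have "\<dots> = overlap (P k) (P (Suc k)) 0 (P m)"
    unfolding unpaired_def using N_le le_2N N_nonneg by (subst overlap_split, simp, simp)+ simp
  also have "\<dots> = P (Suc k) - P k"
    using prefix_sum_nonneg[of k] prefix_sum_mono[of k "Suc k"] prefix_sum_mono[of "Suc k" m] assms
    by (auto simp: overlap_def)
  finally show ?thesis by (simp add: prefix_sum_def)
qed

text \<open>Counted by their upper positions, the pairs contribute S - N; the middle part adds 2 * N
  - S.\<close>

lemma wrap_freq_total: "(\<Sum>(i, j)\<in>index_pairs m. wrap_freq l m N i j) = N"
proof -
  have "(\<Sum>(i, j)\<in>index_pairs m. wrap_freq l m N i j)
    = (\<Sum>i<m. \<Sum>j<m. pair_overlap i j + (if i = j then unpaired i else 0))"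
    unfolding sum_index_pairs by (intro sum.cong refl) (auto simp flip: wrap_freq_eq)
  also have "\<dots> = (\<Sum>i<m. \<Sum>j<m. pair_overlap i j) + (\<Sum>i<m. unpaired i)"
    by (simp add: sum.distrib)
  also have "(\<Sum>i<m. \<Sum>j<m. pair_overlap i j) = (\<Sum>i<m. overlap N (P m) (P i) (P (Suc i)))"
    by (intro sum.cong refl) (simp add: sum_pair_overlap_upper overlap_commute[of N])
  also have "\<dots> = P m - N"
    using sum_overlap_prefix_sum[where c=0] N_le N_nonneg by (auto simp: overlap_def)
  also have "(\<Sum>i<m. unpaired i) = (\<Sum>i<m. overlap (P m - N) N (P i) (P (Suc i)))"
    unfolding unpaired_def by (intro sum.cong refl overlap_commute)
  also have "\<dots> = 2 * N - P m"
    using sum_overlap_prefix_sum[where c=0] N_le le_2N N_nonneg by (auto simp: overlap_def)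
  finally show ?thesis by simp
qed

end

lemma wrap_freq_nonneg: "0 \<le> wrap_freq l m N i j"
  by (simp add: wrap_freq_def overlap_nonneg)

subsection \<open>Optimal line concepts on a star\<close>

locale star_instance =
  fixes I :: "'v lp_instance" and m :: nat and z :: 'v and leaf :: "nat \<Rightarrow> 'v"
  assumes valid: "valid_instance I"
    and d_fix_0: "d_fix I = 0"
    and verts_eq: "verts I = insert z (leaf ` {..<m})"
    and edges_eq: "edges I = (\<lambda>j. {leaf j, z}) ` {..<m}"
    and inj_leaf: "inj_on leaf {..<m}"
    and z_notin: "z \<notin> leaf ` {..<m}"
begin

section \<open>Costs and frequencies counted edge by edge\<close>

definition spoke :: "nat \<Rightarrow> 'v set" where
  "spoke j = {leaf j, z}"

lemma edges_spoke: "edges I = spoke ` {..<m}"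
  by (simp add: edges_eq spoke_def)

lemma inj_spoke: "inj_on spoke {..<m}"
  using inj_leaf z_notin by (auto simp: inj_on_def spoke_def doubleton_eq_iff)

lemma sum_edges: "(\<Sum>e\<in>edges I. h e) = (\<Sum>j<m. h (spoke j))"
  unfolding edges_spoke by (simp add: sum.reindex[OF inj_spoke])

lemma z_in_edge: "e \<in> edges I \<Longrightarrow> z \<in> e"
  by (auto simp: edges_eq)

text \<open>Two disjoint edges of a path cannot both contain the centre.\<close>

lemma card_path_edges_le_2:
  assumes "distinct xs" "path_edges xs \<subseteq> edges I"
  shows "card (path_edges xs) \<le> 2"
proof -
  consider "xs = []" | a where "xs = [a]" | a b where "xs = [a, b]" | a b c where "xs = [a, b, c]"
    | a b c d ys where "xs = a # b # c # d # ys"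
    by (metis list.exhaust)
  then show ?thesis
  proof cases
    case (5 a b c d ys)
    then have "{a, b} \<in> edges I" "{c, d} \<in> edges I" using assms(2) by auto
    then have "z \<in> {a, b}" "z \<in> {c, d}" by (auto dest: z_in_edge)
    then show ?thesis using 5 assms(1) by auto
  qed (auto simp: card_insert_if)
qed

lemma finite_edges: "finite (edges I)"
  by (simp add: edges_eq)

lemma is_line_edges:
  assumes "is_line I l"
  shows "line_edges l \<subseteq> edges I" "card (line_edges l) \<le> 2"
  using assms card_path_edges_le_2 by (auto simp: is_line_def line_of_def)

lemma finite_lines: "finite {l. is_line I l}"
proof (rule finite_subset)
  show "{l. is_line I l} \<subseteq> Pow (verts I) \<times> Pow (edges I)"
    by (auto simp: is_line_def line_of_def)
qed (simp add: finite_edges verts_eq)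

lemma finite_feasible: "feasible I (\<L>, f) \<Longrightarrow> finite \<L>"
  by (rule finite_subset[OF _ finite_lines]) (auto simp: feasible_def)

text \<open>Double counting of pairs of a line and an edge on it. It serves with the edge costs for
  the cost formula and with constant weight 1 for the bound on the total frequency.\<close>

lemma sum_lines_edges:
  fixes f :: "'v line \<Rightarrow> nat" and c :: "'v set \<Rightarrow> real"
  assumes "\<And>l. l \<in> \<L> \<Longrightarrow> is_line I l"
  shows "(\<Sum>l\<in>\<L>. real (f l) * (\<Sum>e\<in>line_edges l. c e))
    = (\<Sum>j<m. c (spoke j) * real (edge_frequency (\<L>, f) (spoke j)))"
proof -
  have fin: "finite \<L>"
    using assms by (intro finite_subset[OF _ finite_lines]) auto
  have "(\<Sum>l\<in>\<L>. real (f l) * (\<Sum>e\<in>line_edges l. c e))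
    = (\<Sum>l\<in>\<L>. \<Sum>e\<in>edges I. if e \<in> line_edges l then c e * real (f l) else 0)"
  proof (rule sum.cong[OF refl])
    fix l assume "l \<in> \<L>"
    then have "line_edges l \<subseteq> edges I" using assms is_line_edges(1) by blast
    then have "(\<Sum>e\<in>edges I. if e \<in> line_edges l then c e * real (f l) else 0)
      = (\<Sum>e\<in>line_edges l. c e * real (f l))"
      by (intro sum.mono_neutral_cong_right finite_edges) auto
    then show "real (f l) * (\<Sum>e\<in>line_edges l. c e)
      = (\<Sum>e\<in>edges I. if e \<in> line_edges l then c e * real (f l) else 0)"
      by (simp add: sum_distrib_left mult.commute)
  qed
  also have "\<dots> = (\<Sum>e\<in>edges I. \<Sum>l\<in>\<L>. if e \<in> line_edges l then c e * real (f l) else 0)"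
    by (rule sum.swap)
  also have "\<dots> = (\<Sum>e\<in>edges I. c e * real (edge_frequency (\<L>, f) e))"
    by (intro sum.cong refl)
      (auto simp: edge_frequency_def sum_distrib_left fin split: if_splits intro!: sum.mono_neutral_cong_right)
  finally show ?thesis by (simp add: sum_edges)
qed

text \<open>The cost thus depends only on the total frequency and the edge frequencies, which can be
  bounded separately.\<close>

lemma concept_cost_eq:
  assumes "\<And>l. l \<in> \<L> \<Longrightarrow> is_line I l"
  shows "concept_cost I (\<L>, f) = c_fix I * real (\<Sum>l\<in>\<L>. f l)
    + (\<Sum>j<m. edge_cost I (spoke j) * real (edge_frequency (\<L>, f) (spoke j)))"
proof -
  have "concept_cost I (\<L>, f) = (\<Sum>l\<in>\<L>. c_fix I * real (f l))
      + (\<Sum>l\<in>\<L>. real (f l) * (\<Sum>e\<in>line_edges l. edge_cost I e))"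
    by (simp add: concept_cost_def d_fix_0 distrib_left sum.distrib mult.commute)
  then show ?thesis
    using sum_lines_edges[OF assms, of \<L> f "edge_cost I"] by (simp add: sum_distrib_left)
qed

section \<open>Lower bounds on edge frequencies and on the total frequency\<close>

definition demand :: "nat \<Rightarrow> int" where
  "demand j = max 0 (f_min I (spoke j))"

lemma demand_nonneg: "0 \<le> demand j"
  by (simp add: demand_def)

text \<open>Frequencies are natural numbers, which is why \<open>demand\<close> may raise a negative
  lower bound to 0.\<close>

lemma demand_le:
  assumes "feasible I \<C>" "j < m"
  shows "demand j \<le> int (edge_frequency \<C> (spoke j))"
  using assms by (auto simp: feasible_def demand_def edges_spoke)

text \<open>The lines over one edge are among all lines; and a line serves at most two edges, so the
  edge frequencies sum to at most twice the total.\<close>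

lemma total_ge:
  assumes "feasible I (\<L>, f)"
  shows "j < m \<Longrightarrow> demand j \<le> int (\<Sum>l\<in>\<L>. f l)"
    and "prefix_sum demand m \<le> 2 * int (\<Sum>l\<in>\<L>. f l)"
proof -
  note fin = finite_feasible[OF assms]
  show "demand j \<le> int (\<Sum>l\<in>\<L>. f l)" if "j < m"
  proof -
    have "edge_frequency (\<L>, f) (spoke j) \<le> (\<Sum>l\<in>\<L>. f l)"
      unfolding edge_frequency_def prod.case by (rule sum_mono2) (use fin in auto)
    with demand_le[OF assms that] show ?thesis by linarith
  qed
  have lines: "is_line I l" if "l \<in> \<L>" for l
    using assms that by (auto simp: feasible_def)
  have "real_of_int (prefix_sum demand m) \<le> (\<Sum>j<m. 1 * real (edge_frequency (\<L>, f) (spoke j)))"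
    unfolding prefix_sum_def of_int_sum
    by (rule sum_mono) (use demand_le[OF assms] in force)
  also have "\<dots> = (\<Sum>l\<in>\<L>. real (f l) * (\<Sum>e\<in>line_edges l. 1))"
    using sum_lines_edges[OF lines, of \<L> f "\<lambda>_. 1"] by simp
  also have "\<dots> \<le> (\<Sum>l\<in>\<L>. real (f l) * 2)"
    by (intro sum_mono mult_left_mono) (use is_line_edges(2)[OF lines] in force)+
  also have "\<dots> = 2 * real (\<Sum>l\<in>\<L>. f l)"
    by (simp add: sum_distrib_left mult.commute)
  finally show "prefix_sum demand m \<le> 2 * int (\<Sum>l\<in>\<L>. f l)"
    by (simp add: of_int_le_iff[symmetric, where 'a=real] del: of_int_le_iff)
qed

section \<open>Lines over one or two spokes and the wrap-around concept\<close>

fun pair_path :: "nat \<times> nat \<Rightarrow> 'v list" where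
  "pair_path (i, j) = (if j < i then [leaf i, z, leaf j] else [leaf i, z])"

text \<open>The diagonal index (i, i) stands for the one-edge line;
  \<open>{spoke i, spoke j}\<close> then collapses to a singleton, so one formula fits both
  kinds.\<close>

lemma pair_path:
  assumes "(i, j) \<in> index_pairs m"
  shows "distinct (pair_path (i, j))" "is_line I (line_of (pair_path (i, j)))"
    "line_edges (line_of (pair_path (i, j))) = {spoke i, spoke j}"
proof -
  have ij: "i < m" "j \<le> i" "leaf i \<noteq> z" "leaf j \<noteq> z" "j < i \<Longrightarrow> leaf i \<noteq> leaf j"
    using assms z_notin inj_onD[OF inj_leaf, of i j] by (auto simp: index_pairs_def image_iff)
  then show d: "distinct (pair_path (i, j))" by auto
  show e: "line_edges (line_of (pair_path (i, j))) = {spoke i, spoke j}"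
    using ij by (auto simp: line_of_def spoke_def insert_commute)
  show "is_line I (line_of (pair_path (i, j)))"
    unfolding is_line_def
  proof (intro exI[of _ "pair_path (i, j)"] conjI d refl)
    show "path_edges (pair_path (i, j)) \<subseteq> edges I"
      using e ij by (simp only: line_of_def snd_conv edges_spoke) auto
  qed (use ij in \<open>auto simp: verts_eq\<close>)
qed

text \<open>The edge set of the line determines {i, j} by injectivity of \<open>spoke\<close>, and j
  <= i fixes the order.\<close>

lemma inj_pair_line: "inj_on (\<lambda>p. line_of (pair_path p)) (index_pairs m)"
proof (rule inj_onI)
  fix p q
  assume p: "p \<in> index_pairs m" and q: "q \<in> index_pairs m"
    and eq: "line_of (pair_path p) = line_of (pair_path q)"
  obtain i j i' j' where ij: "p = (i, j)" "q = (i', j')"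
    by (metis surj_pair)
  have "{spoke i, spoke j} = {spoke i', spoke j'}"
    using pair_path(3) p q eq by (metis ij)
  moreover have "i < m" "j \<le> i" "i' < m" "j' \<le> i'"
    using p q by (auto simp: ij index_pairs_def)
  ultimately have "{i, j} = {i', j'}"
    using inj_on_image_eq_iff[OF inj_spoke, of "{i, j}" "{i', j'}"] by auto
  then show "p = q"
    using \<open>j \<le> i\<close> \<open>j' \<le> i'\<close> by (auto simp: ij doubleton_eq_iff)
qed

definition pair_lines :: "'v line set" where
  "pair_lines = (\<lambda>p. line_of (pair_path p)) ` index_pairs m"

text \<open>All lines with at least one edge are used, many of them with frequency zero; this is free
  because of \<open>d_fix = 0\<close>.\<close>

definition wrap_concept :: "int \<Rightarrow> 'v line_concept" where
  "wrap_concept N = (pair_lines,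
     \<lambda>l. case inv_into (index_pairs m) (\<lambda>p. line_of (pair_path p)) l of
           (i, j) \<Rightarrow> nat (wrap_freq demand m N i j))"

lemma wrap_concept_freq:
  "(i, j) \<in> index_pairs m \<Longrightarrow>
     snd (wrap_concept N) (line_of (pair_path (i, j))) = nat (wrap_freq demand m N i j)"
  by (simp add: wrap_concept_def inv_into_f_f[OF inj_pair_line] del: pair_path.simps)

text \<open>The predicate \<open>R\<close> lets one reindexing yield both an edge frequency
  (\<open>R\<close> tests for a spoke) and the total (\<open>R\<close> always true).\<close>

lemma wrap_concept_sum:
  "int (\<Sum>l\<in>{l\<in>pair_lines. R (line_edges l)}. snd (wrap_concept N) l)
    = (\<Sum>(i, j)\<in>index_pairs m. if R {spoke i, spoke j} then wrap_freq demand m N i j else 0)"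
proof -
  have "(\<Sum>l\<in>{l\<in>pair_lines. R (line_edges l)}. snd (wrap_concept N) l)
    = (\<Sum>l\<in>pair_lines. if R (line_edges l) then snd (wrap_concept N) l else 0)"
    by (rule sum.inter_filter) (simp add: pair_lines_def)
  also have "\<dots> = (\<Sum>p\<in>index_pairs m. if R (line_edges (line_of (pair_path p)))
      then snd (wrap_concept N) (line_of (pair_path p)) else 0)"
    unfolding pair_lines_def by (simp add: sum.reindex[OF inj_pair_line])
  also have "int \<dots> = (\<Sum>(i, j)\<in>index_pairs m. if R {spoke i, spoke j} then wrap_freq demand m N i j else 0)"
    unfolding of_nat_sum
    by (intro sum.cong refl)
      (auto simp: wrap_concept_freq pair_path(3) wrap_freq_nonneg simp del: pair_path.simps)
  finally show ?thesis .
qed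

text \<open>The first argument is S / 2 rounded up; \<open>insert 0\<close> keeps \<open>Max\<close>
  meaningful for m = 0.\<close>

definition num_trips :: int where
  "num_trips = max ((prefix_sum demand m + 1) div 2) (Max (insert 0 (demand ` {..<m})))"

text \<open>These are the conditions of \<open>wrap_around\<close>. The bound by S uses that S is a
  nonnegative integer and that no single demand exceeds the sum.\<close>

lemma num_trips:
  shows "j < m \<Longrightarrow> demand j \<le> num_trips"
    and "num_trips \<le> prefix_sum demand m"
    and "prefix_sum demand m \<le> 2 * num_trips"
proof -
  show "demand j \<le> num_trips" if "j < m"
    unfolding num_trips_def using that by (intro max.coboundedI2 Max_ge) auto
  have nn: "0 \<le> prefix_sum demand m"
    unfolding prefix_sum_def by (rule sum_nonneg) (simp add: demand_nonneg)
  have "demand j \<le> prefix_sum demand m" if "j < m" for j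
    unfolding prefix_sum_def using that by (intro member_le_sum) (auto simp: demand_nonneg)
  then have "Max (insert 0 (demand ` {..<m})) \<le> prefix_sum demand m"
    using nn by (subst Max_le_iff) auto
  then show "num_trips \<le> prefix_sum demand m"
    unfolding num_trips_def using nn by auto
  have "prefix_sum demand m \<le> 2 * ((prefix_sum demand m + 1) div 2)" by linarith
  then show "prefix_sum demand m \<le> 2 * num_trips"
    unfolding num_trips_def by linarith
qed

text \<open>The total frequency is an integer, so being at least S / 2 it is at least the rounded-up
  value.\<close>

lemma num_trips_le:
  assumes "feasible I (\<L>, f)"
  shows "num_trips \<le> int (\<Sum>l\<in>\<L>. f l)"
proof -
  have "Max (insert 0 (demand ` {..<m})) \<le> int (\<Sum>l\<in>\<L>. f l)"
    using total_ge(1)[OF assms] by (subst Max_le_iff) (auto intro: sum_nonneg)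
  moreover have "(prefix_sum demand m + 1) div 2 \<le> int (\<Sum>l\<in>\<L>. f l)"
    using total_ge(2)[OF assms] by linarith
  ultimately show ?thesis by (simp add: num_trips_def)
qed

lemma wrap_around_demand: "wrap_around demand m num_trips"
  by unfold_locales (use num_trips demand_nonneg in auto)

lemma wrap_concept_edge_frequency:
  assumes "k < m"
  shows "int (edge_frequency (wrap_concept num_trips) (spoke k)) = demand k"
proof -
  have "int (edge_frequency (wrap_concept num_trips) (spoke k))
    = int (\<Sum>l\<in>{l\<in>pair_lines. spoke k \<in> line_edges l}. snd (wrap_concept num_trips) l)"
    by (simp add: edge_frequency_def wrap_concept_def)
  also have "\<dots> = (\<Sum>(i, j)\<in>index_pairs m.
      if k = i \<or> k = j then wrap_freq demand m num_trips i j else 0)"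
    unfolding wrap_concept_sum[where R = "\<lambda>E. spoke k \<in> E"]
    using assms inj_spoke by (intro sum.cong refl) (auto simp: index_pairs_def inj_on_def)
  also have "\<dots> = demand k"
    by (rule wrap_around.wrap_freq_degree[OF wrap_around_demand assms])
  finally show ?thesis .
qed

lemma wrap_concept_total: "int (\<Sum>l\<in>pair_lines. snd (wrap_concept num_trips) l) = num_trips"
  using wrap_concept_sum[where R = "\<lambda>_. True" and N = num_trips]
    wrap_around.wrap_freq_total[OF wrap_around_demand] by simp

lemma pair_lines_is_line: "l \<in> pair_lines \<Longrightarrow> is_line I l"
  unfolding pair_lines_def using pair_path(2) by auto

text \<open>Bounds are arbitrary integers, so an upper bound may be negative; this is the only
  obstruction to feasibility.\<close>

definition upper_nonneg :: "nat \<Rightarrow> bool" where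
  "upper_nonneg j \<longleftrightarrow> le_upper 0 (f_max I (spoke j))"

lemma feasible_imp_upper_nonneg: "feasible I \<C> \<Longrightarrow> j < m \<Longrightarrow> upper_nonneg j"
  unfolding feasible_def upper_nonneg_def le_upper_def edges_spoke
  by (force split: option.splits)

text \<open>Every edge gets exactly its demand and the total equals \<open>num_trips\<close>, so
  both summands of the cost reach their lower bounds at once.\<close>

lemma wrap_concept_optimal:
  assumes "\<And>j. j < m \<Longrightarrow> upper_nonneg j"
  shows "optimal I (wrap_concept num_trips)"
proof -
  define f where "f = snd (wrap_concept num_trips)"
  have C: "wrap_concept num_trips = (pair_lines, f)"
    by (simp add: f_def wrap_concept_def)
  have freq: "int (edge_frequency (pair_lines, f) (spoke k)) = demand k" if "k < m" for k
    using wrap_concept_edge_frequency[OF that] by (simp add: C)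
  have "feasible I (pair_lines, f)"
    unfolding feasible_def
  proof (intro conjI ballI)
    fix e assume "e \<in> edges I"
    then obtain k where k: "k < m" "e = spoke k" by (auto simp: edges_spoke)
    have "le_upper (f_min I e) (f_max I e)"
      using valid \<open>e \<in> edges I\<close> by (auto simp: valid_instance_def)
    then show "f_min I e \<le> int (edge_frequency (pair_lines, f) e)"
      "le_upper (int (edge_frequency (pair_lines, f) e)) (f_max I e)"
      using assms[OF k(1)]
      by (auto simp: k freq demand_def upper_nonneg_def le_upper_def split: option.splits)
  qed (auto simp: pair_lines_is_line)
  moreover have "concept_cost I (pair_lines, f) \<le> concept_cost I \<C>" if feas: "feasible I \<C>" for \<C>
  proof -
    obtain \<L> g where C': "\<C> = (\<L>, g)" by force
    have "int (\<Sum>l\<in>pair_lines. f l) \<le> int (\<Sum>l\<in>\<L>. g l)"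
      using num_trips_le feas wrap_concept_total unfolding C' f_def by simp
    then have "real (\<Sum>l\<in>pair_lines. f l) \<le> real (\<Sum>l\<in>\<L>. g l)"
      by (simp only: of_nat_le_iff)
    then have "c_fix I * real (\<Sum>l\<in>pair_lines. f l) \<le> c_fix I * real (\<Sum>l\<in>\<L>. g l)"
      using valid by (intro mult_left_mono) (simp_all add: valid_instance_def)
    moreover have "(\<Sum>j<m. edge_cost I (spoke j) * real (edge_frequency (pair_lines, f) (spoke j)))
      \<le> (\<Sum>j<m. edge_cost I (spoke j) * real (edge_frequency \<C> (spoke j)))"
    proof (intro sum_mono mult_left_mono)
      fix j assume "j \<in> {..<m}"
      then show "real (edge_frequency (pair_lines, f) (spoke j)) \<le> real (edge_frequency \<C> (spoke j))"
        using demand_le[OF feas, of j] freq[of j] by simp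
      show "0 \<le> edge_cost I (spoke j)"
        using valid \<open>j \<in> {..<m}\<close> by (auto simp: valid_instance_def edges_spoke)
    qed
    moreover have "\<And>l. l \<in> \<L> \<Longrightarrow> is_line I l"
      using feas by (auto simp: C' feasible_def)
    ultimately show ?thesis
      by (simp add: C' concept_cost_eq pair_lines_is_line)
  qed
  ultimately show ?thesis by (simp add: optimal_def C)
qed

lemma feasible_iff: "(\<exists>\<C>. feasible I \<C>) \<longleftrightarrow> (\<forall>j<m. upper_nonneg j)"
  using feasible_imp_upper_nonneg wrap_concept_optimal unfolding optimal_def by blast

end

subsection \<open>Weakest preconditions with running time\<close>

text \<open>Total correctness with the running time passed to the postcondition. Determinism of
  \<open>exec\<close> turns the rules for single commands into equivalences usable for
  rewriting.\<close>

definition wp :: "com \<Rightarrow> (nat \<Rightarrow> state \<Rightarrow> bool) \<Rightarrow> state \<Rightarrow> bool" where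
  "wp c Q s \<longleftrightarrow> (\<exists>t s'. exec c s t s' \<and> Q t s')"

lemma wp_mono: "wp c Q s \<Longrightarrow> (\<And>t s'. Q t s' \<Longrightarrow> Q' t s') \<Longrightarrow> wp c Q' s"
  by (auto simp: wp_def)

lemma wp_Skip [simp]: "wp Skip Q s \<longleftrightarrow> Q 1 s"
  unfolding wp_def by (metis exec.Skip exec_deterministic)

lemma wp_IAssign [simp]:
  "wp (IAssign x e) Q s \<longleftrightarrow> Q (1 + itime e) (s\<lparr>ivar := (ivar s)(x := ival e s)\<rparr>)"
  unfolding wp_def by (metis exec.IAssign exec_deterministic)

lemma wp_IStore [simp]:
  "wp (IStore a i e) Q s \<longleftrightarrow> Q (1 + itime i + itime e)
     (s\<lparr>iarr := (iarr s)(a := (iarr s a)(ival i s := ival e s))\<rparr>)"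
  unfolding wp_def by (metis exec.IStore exec_deterministic)

lemma wp_Seq [simp]:
  "wp (Seq c1 c2) Q s \<longleftrightarrow> wp c1 (\<lambda>t1. wp c2 (\<lambda>t2. Q (t1 + t2))) s"
  unfolding wp_def by (blast intro: exec.Seq elim: exec_elims)

lemma wp_If [simp]:
  "wp (If b c1 c2) Q s \<longleftrightarrow>
     (if bval b s then wp c1 (\<lambda>t. Q (1 + btime b + t)) s
      else wp c2 (\<lambda>t. Q (1 + btime b + t)) s)"
  unfolding wp_def
  by (auto simp: add.assoc elim!: exec_elims(7)) (metis exec.IfTrue exec.IfFalse plus_1_eq_Suc add_Suc)+

text \<open>The invariant is indexed by the number of completed iterations: \<open>K\<close> rounds
  of at most \<open>T\<close> steps, each with one test, and a final failing test.\<close>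

lemma wp_While:
  assumes "Inv 0 s"
    and step: "\<And>k s. k < K \<Longrightarrow> Inv k s \<Longrightarrow>
      bval b s \<and> wp c (\<lambda>t s'. t \<le> T \<and> Inv (Suc k) s') s"
    and exit: "\<And>s. Inv K s \<Longrightarrow> \<not> bval b s"
  shows "wp (While b c) (\<lambda>t s'. t \<le> K * (1 + btime b + T) + (1 + btime b) \<and> Inv K s') s"
proof -
  \<comment> \<open>Generalised to a start after \<open>k\<close> rounds with \<open>d\<close>
    rounds left, for induction on \<open>d\<close>.\<close>
  have "wp (While b c) (\<lambda>t s'. t \<le> d * (1 + btime b + T) + (1 + btime b) \<and> Inv K s') s"
    if "Inv k s" "k + d = K" for k d s
    using that
  proof (induction d arbitrary: k s)
    case 0
    with exit have "exec (While b c) s (1 + btime b) s"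
      by (intro exec.WhileFalse) auto
    with 0 show ?case by (auto simp: wp_def)
  next
    case (Suc d)
    from step[of k s] Suc.prems obtain t1 s1
      where b: "bval b s" and 1: "exec c s t1 s1" "t1 \<le> T" "Inv (Suc k) s1"
      by (auto simp: wp_def)
    from Suc.IH[of "Suc k" s1] 1 Suc.prems obtain t2 s2
      where 2: "exec (While b c) s1 t2 s2" "t2 \<le> d * (1 + btime b + T) + (1 + btime b)" "Inv K s2"
      by (auto simp: wp_def)
    from b 1(1) 2(1) have "exec (While b c) s (1 + btime b + t1 + t2) s2"
      by (rule exec.WhileTrue)
    with 1 2 show ?case unfolding wp_def by (fastforce simp: algebra_simps)
  qed
  from this[of 0 s K] assms(1) show ?thesis by simp
qed

subsection \<open>The program\<close>

abbreviation seq (infixr ";;" 60) where "c1 ;; c2 \<equiv> Seq c1 c2"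

definition eq_exp :: "iexp \<Rightarrow> iexp \<Rightarrow> bexp" where
  "eq_exp e1 e2 = BAnd (BNot (ILess e1 e2)) (BNot (ILess e2 e1))"

lemma eq_exp [simp]:
  "bval (eq_exp e1 e2) s \<longleftrightarrow> ival e1 s = ival e2 s"
  "btime (eq_exp e1 e2) = 5 + 2 * (itime e1 + itime e2)"
  by (auto simp: eq_exp_def)

text \<open>
  With two or more edges, the centre is their common endpoint. With a single edge, the entries at
  index 1 are arbitrary, but either endpoint may then serve as the centre.
\<close>

definition find_centre :: com where
  "find_centre =
    If (eq_exp (IArr ''edge_fst'' (IConst 0)) (IArr ''edge_fst'' (IConst 1)))
      (IAssign ''z'' (IArr ''edge_fst'' (IConst 0)))
      (If (eq_exp (IArr ''edge_fst'' (IConst 0)) (IArr ''edge_snd'' (IConst 1)))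
        (IAssign ''z'' (IArr ''edge_fst'' (IConst 0)))
        (IAssign ''z'' (IArr ''edge_snd'' (IConst 0))))"

definition scan_init :: com where
  "scan_init =
    find_centre ;;
    IAssign ''i'' (IConst 0) ;;
    IAssign ''M'' (IConst 0) ;;
    IAssign ''feasible'' (IConst 1) ;;
    IStore ''P'' (IConst 0) (IConst 0)"

text \<open>Subtracting the centre from the sum of the endpoints yields the leaf whatever the order
  of the endpoints.\<close>

definition scan_step :: com where
  "scan_step =
    IStore ''leaf'' (IVar ''i'')
      (ISub (IAdd (IArr ''edge_fst'' (IVar ''i'')) (IArr ''edge_snd'' (IVar ''i''))) (IVar ''z'')) ;;
    If (BAnd (ILess (IArr ''f_max_infinite'' (IVar ''i'')) (IConst 1))
             (ILess (IArr ''f_max'' (IVar ''i'')) (IConst 0)))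
      (IAssign ''feasible'' (IConst 0)) Skip ;;
    If (ILess (IConst 0) (IArr ''f_min'' (IVar ''i'')))
      (IAssign ''l'' (IArr ''f_min'' (IVar ''i''))) (IAssign ''l'' (IConst 0)) ;;
    IStore ''P'' (IAdd (IVar ''i'') (IConst 1)) (IAdd (IArr ''P'' (IVar ''i'')) (IVar ''l'')) ;;
    If (ILess (IVar ''M'') (IVar ''l'')) (IAssign ''M'' (IVar ''l'')) Skip ;;
    IAssign ''i'' (IAdd (IVar ''i'') (IConst 1))"

definition compute_trips :: com where
  "compute_trips =
    IAssign ''S'' (IArr ''P'' (IVar ''m'')) ;;
    IAssign ''N'' (IHalf (IAdd (IVar ''S'') (IConst 1))) ;;
    If (ILess (IVar ''N'') (IVar ''M'')) (IAssign ''N'' (IVar ''M'')) Skip"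

definition compute_overlap :: com where
  "compute_overlap =
    If (ILess (IVar ''a'') (IVar ''c'')) (IAssign ''a'' (IVar ''c'')) Skip ;;
    If (ILess (IVar ''d'') (IVar ''b'')) (IAssign ''b'' (IVar ''d'')) Skip ;;
    If (ILess (IVar ''a'') (IVar ''b''))
      (IAssign ''v'' (ISub (IVar ''b'') (IVar ''a''))) (IAssign ''v'' (IConst 0))"

text \<open>\<open>q\<close> advances before \<open>offset\<close> is stored: the entry is the end
  of the line just written and the start of the next.\<close>

definition finish_line :: com where
  "finish_line =
    IStore ''frequency'' (IVar ''q'') (IVar ''v'') ;;
    IAssign ''q'' (IAdd (IVar ''q'') (IConst 1)) ;;
    IStore ''offset'' (IVar ''q'') (IVar ''o'')"

definition push :: "iexp \<Rightarrow> com" where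
  "push e = IStore ''path'' (IVar ''o'') e ;; IAssign ''o'' (IAdd (IVar ''o'') (IConst 1))"

definition pair_step :: com where
  "pair_step =
    IAssign ''a'' (IArr ''P'' (IVar ''j'')) ;;
    IAssign ''b'' (IArr ''P'' (IAdd (IVar ''j'') (IConst 1))) ;;
    IAssign ''c'' (ISub (IArr ''P'' (IVar ''i'')) (IVar ''N'')) ;;
    IAssign ''d'' (ISub (IArr ''P'' (IAdd (IVar ''i'') (IConst 1))) (IVar ''N'')) ;;
    compute_overlap ;;
    push (IArr ''leaf'' (IVar ''i'')) ;;
    push (IVar ''z'') ;;
    push (IArr ''leaf'' (IVar ''j'')) ;;
    finish_line ;;
    IAssign ''j'' (IAdd (IVar ''j'') (IConst 1))"

definition single_step :: com where
  "single_step =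
    IAssign ''a'' (IArr ''P'' (IVar ''i'')) ;;
    IAssign ''b'' (IArr ''P'' (IAdd (IVar ''i'') (IConst 1))) ;;
    IAssign ''c'' (ISub (IVar ''S'') (IVar ''N'')) ;;
    IAssign ''d'' (IVar ''N'') ;;
    compute_overlap ;;
    push (IArr ''leaf'' (IVar ''i'')) ;;
    push (IVar ''z'') ;;
    finish_line ;;
    IAssign ''i'' (IAdd (IVar ''i'') (IConst 1))"

definition row_step :: com where
  "row_step =
    IAssign ''j'' (IConst 0) ;;
    While (ILess (IVar ''j'') (IVar ''i'')) pair_step ;;
    single_step"

definition emit_init :: com where
  "emit_init =
    IAssign ''q'' (IConst 0) ;;
    IAssign ''o'' (IConst 0) ;;
    IStore ''offset'' (IConst 0) (IConst 0) ;;
    IAssign ''i'' (IConst 0)"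

text \<open>The emitted concept is determined by the star and the demands alone, and is optimal for
  every choice of nonnegative costs.\<close>

definition star_program :: com where
  "star_program =
    scan_init ;;
    While (ILess (IVar ''i'') (IVar ''m'')) scan_step ;;
    compute_trips ;;
    emit_init ;;
    While (ILess (IVar ''i'') (IVar ''m'')) row_step ;;
    IAssign ''num_lines'' (IVar ''q'')"

text \<open>The eight branch combinations collapse into one closed form, so later proofs need no
  case split; \<open>a\<close> and \<open>b\<close> are overwritten by the clipped ends.\<close>

lemma wp_compute_overlap:
  assumes "\<And>t. t \<le> 30 \<Longrightarrow> Q t (s\<lparr>ivar := (ivar s)
      (''a'' := max (ivar s ''a'') (ivar s ''c''), ''b'' := min (ivar s ''b'') (ivar s ''d''),
       ''v'' := overlap (ivar s ''a'') (ivar s ''b'') (ivar s ''c'') (ivar s ''d''))\<rparr>)"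
  shows "wp compute_overlap Q s"
proof -
  have "wp compute_overlap (\<lambda>t s'. t \<le> 30 \<and> s' = s\<lparr>ivar := (ivar s)
      (''a'' := max (ivar s ''a'') (ivar s ''c''), ''b'' := min (ivar s ''b'') (ivar s ''d''),
       ''v'' := overlap (ivar s ''a'') (ivar s ''b'') (ivar s ''c'') (ivar s ''d''))\<rparr>) s"
    by (auto simp: compute_overlap_def overlap_def max_def min_def fun_upd_twist fun_upd_idem_iff
        intro!: state.equality ext)
  then show ?thesis by (rule wp_mono) (use assms in auto)
qed

text \<open>The order in which the program emits lines: row \<open>i\<close> lists the partners
  below \<open>i\<close>, then the single line (i, i).\<close>

definition pair_list :: "nat \<Rightarrow> (nat \<times> nat) list" where
  "pair_list k = concat (map (\<lambda>i. map (Pair i) [0..<Suc i]) [0..<k])"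

lemma pair_list_Suc: "pair_list (Suc k) = pair_list k @ map (Pair k) [0..<Suc k]"
  by (simp add: pair_list_def)

lemma set_pair_list: "set (pair_list m) = index_pairs m"
  by (auto simp: pair_list_def index_pairs_def image_iff simp del: upt_Suc)

lemma distinct_pair_list: "distinct (pair_list m)"
proof (induction m)
  case (Suc m)
  then show ?case
    by (auto simp: pair_list_Suc set_pair_list index_pairs_def distinct_map inj_on_def
        simp del: upt_Suc)
qed (simp add: pair_list_def)

text \<open>Relates positions in the flat \<open>path\<close> array to entry \<open>k\<close> of
  line \<open>i\<close>: the preceding lines occupy the first places.\<close>

lemma concat_take_nth:
  assumes "i < length xss" "k < length (xss ! i)"
  shows "length (concat (take i xss)) + k < length (concat xss)"
    "concat xss ! (length (concat (take i xss)) + k) = xss ! i ! k"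
proof -
  have "concat xss = concat (take i xss) @ xss ! i @ concat (drop (Suc i) xss)"
    using assms(1) by (metis concat.simps(2) concat_append id_take_nth_drop)
  then show "length (concat (take i xss)) + k < length (concat xss)"
    "concat xss ! (length (concat (take i xss)) + k) = xss ! i ! k"
    using assms(2) by (simp_all add: nth_append)
qed

subsection \<open>Correctness and running time\<close>

locale nat_star_instance = star_instance I m z leaf
  for I :: "nat lp_instance" and m z leaf
begin

text \<open>Of the endpoints only the sum is recorded, as it does not depend on their order; the
  order matters for the centre, which \<open>centre_found\<close> treats.\<close>

definition input :: "state \<Rightarrow> bool" where
  "input s \<longleftrightarrow> ivar s ''m'' = int m \<and>
     (\<forall>j<m. iarr s ''edge_fst'' (int j) + iarr s ''edge_snd'' (int j) = int (leaf j) + int z \<and>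
        iarr s ''f_min'' (int j) = f_min I (spoke j) \<and>
        (iarr s ''f_max_infinite'' (int j) < 1 \<and> iarr s ''f_max'' (int j) < 0
           \<longleftrightarrow> \<not> upper_nonneg j))"

text \<open>The claim on \<open>z\<close> is guarded by 0 < m, since without edges the array entries
  it is read from are arbitrary.\<close>

definition scan_inv :: "nat \<Rightarrow> state \<Rightarrow> bool" where
  "scan_inv k s \<longleftrightarrow> input s \<and> ivar s ''i'' = int k \<and> (0 < m \<longrightarrow> ivar s ''z'' = int z) \<and>
     (\<forall>j<k. iarr s ''leaf'' (int j) = int (leaf j)) \<and>
     (\<forall>j\<le>k. iarr s ''P'' (int j) = prefix_sum demand j) \<and>
     ivar s ''M'' = Max (insert 0 (demand ` {..<k})) \<and>
     ivar s ''feasible'' = (if \<forall>j<k. upper_nonneg j then 1 else 0)"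

lemma scan_step:
  assumes "k < m" "scan_inv k s"
  shows "wp scan_step (\<lambda>t s'. t \<le> 60 \<and> scan_inv (Suc k) s') s"
proof -
  define M d where "M = Max (insert 0 (demand ` {..<k}))" and "d = demand k"
  have M: "Max (insert 0 (demand ` {..<Suc k})) = max d M"
    by (simp add: lessThan_Suc insert_commute[of 0] M_def d_def)
  have P: "prefix_sum demand (Suc k) = prefix_sum demand k + d"
    by (simp add: prefix_sum_def d_def)
  have d: "d = max 0 (f_min I (spoke k))"
    by (simp add: d_def demand_def)
  show ?thesis
    using assms unfolding scan_inv_def M M_def[symmetric]
    by (auto simp: scan_step_def input_def less_Suc_eq le_Suc_eq P d)
qed

definition ready :: "state \<Rightarrow> bool" where
  "ready s \<longleftrightarrow> ivar s ''m'' = int m \<and> (0 < m \<longrightarrow> ivar s ''z'' = int z) \<and>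
     ivar s ''S'' = prefix_sum demand m \<and> ivar s ''N'' = num_trips \<and>
     (\<forall>j<m. iarr s ''leaf'' (int j) = int (leaf j)) \<and>
     (\<forall>j\<le>m. iarr s ''P'' (int j) = prefix_sum demand j) \<and>
     ivar s ''feasible'' = (if \<forall>j<m. upper_nonneg j then 1 else 0)"

lemma ready_prefix_sum:
  "ready s \<Longrightarrow> j < m \<Longrightarrow> iarr s ''P'' (int j) = prefix_sum demand j"
  "ready s \<Longrightarrow> j < m \<Longrightarrow> iarr s ''P'' (int j + 1) = prefix_sum demand (Suc j)"
  by (auto simp: ready_def add.commute[of _ 1] simp flip: of_nat_Suc)

text \<open>The offset clause includes i = \<open>length ps\<close>, which fixes the end of the last
  line.\<close>

definition written :: "(nat \<times> nat) list \<Rightarrow> state \<Rightarrow> bool" where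
  "written ps s \<longleftrightarrow>
     ivar s ''q'' = int (length ps) \<and>
     ivar s ''o'' = int (length (concat (map pair_path ps))) \<and>
     (\<forall>i\<le>length ps. iarr s ''offset'' (int i) = int (length (concat (map pair_path (take i ps))))) \<and>
     (\<forall>i<length ps. iarr s ''frequency'' (int i)
        = wrap_freq demand m num_trips (fst (ps ! i)) (snd (ps ! i))) \<and>
     (\<forall>k<length (concat (map pair_path ps)).
        iarr s ''path'' (int k) = int (concat (map pair_path ps) ! k))"

text \<open>Stated through the changed cells only, so that it fits both the three-vertex and the
  two-vertex lines.\<close>

lemma written_snoc:
  assumes w: "written ps s"
    and q: "ivar s' ''q'' = ivar s ''q'' + 1"
    and o: "ivar s' ''o'' = ivar s ''o'' + int (length (pair_path p))"
    and off: "iarr s' ''offset'' = (iarr s ''offset'')(ivar s ''q'' + 1 := ivar s' ''o'')"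
    and freq: "iarr s' ''frequency'' = (iarr s ''frequency'')
       (ivar s ''q'' := wrap_freq demand m num_trips (fst p) (snd p))"
    and old: "\<And>k. k < ivar s ''o'' \<Longrightarrow> iarr s' ''path'' k = iarr s ''path'' k"
    and new: "\<And>k. k < length (pair_path p) \<Longrightarrow>
       iarr s' ''path'' (ivar s ''o'' + int k) = int (pair_path p ! k)"
  shows "written (ps @ [p]) s'"
proof -
  have "iarr s' ''path'' (int k) = int ((concat (map pair_path ps) @ pair_path p) ! k)"
    if "k < length (concat (map pair_path ps)) + length (pair_path p)" for k
  proof (cases "k < length (concat (map pair_path ps))")
    case True
    then show ?thesis using w old[of "int k"] by (simp add: written_def nth_append)
  next
    case False
    then show ?thesis
      using that w new[of "k - length (concat (map pair_path ps))"]
      by (simp add: written_def nth_append)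
  qed
  moreover have "iarr s' ''offset'' (int i) = int (length (concat (map pair_path (take i (ps @ [p])))))"
    if "i \<le> Suc (length ps)" for i
    using that w by (cases "i = Suc (length ps)") (auto simp: written_def off o)
  moreover have "iarr s' ''frequency'' (int i)
      = wrap_freq demand m num_trips (fst ((ps @ [p]) ! i)) (snd ((ps @ [p]) ! i))"
    if "i < Suc (length ps)" for i
    using that w by (cases "i = length ps") (auto simp: written_def freq nth_append)
  ultimately show ?thesis
    using w q o unfolding written_def by simp
qed

lemma pair_step:
  assumes "i < m" "j < i" "ready s" "written ps s" "ivar s ''i'' = int i" "ivar s ''j'' = int j"
  shows "wp pair_step (\<lambda>t s'. t \<le> 120 \<and> ready s' \<and> written (ps @ [(i, j)]) s' \<and>
    ivar s' ''i'' = int i \<and> ivar s' ''j'' = int (Suc j)) s"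
proof -
  have P: "iarr s ''P'' (int j) = prefix_sum demand j" "iarr s ''P'' (int j + 1) = prefix_sum demand (Suc j)"
    "iarr s ''P'' (int i) = prefix_sum demand i" "iarr s ''P'' (int i + 1) = prefix_sum demand (Suc i)"
    using ready_prefix_sum[OF \<open>ready s\<close>] assms by auto
  show ?thesis
    unfolding pair_step_def wp_Seq wp_IAssign
    apply (rule wp_compute_overlap)
    using assms P
    apply (simp add: push_def finish_line_def)
    apply (intro conjI)
     apply (simp add: ready_def)
    apply (rule written_snoc[OF \<open>written ps s\<close>])
    \<comment> \<open>Unfolding 3 as a successor splits the index of the new path entries into its
      three values.\<close>
    apply (auto simp: ready_def wrap_freq_def less_Suc_eq numeral_3_eq_3)
    done
qed

lemma single_step:
  assumes "i < m" "ready s" "written ps s" "ivar s ''i'' = int i"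
  shows "wp single_step (\<lambda>t s'. t \<le> 120 \<and> ready s' \<and> written (ps @ [(i, i)]) s' \<and>
    ivar s' ''i'' = int (Suc i)) s"
proof -
  have P: "iarr s ''P'' (int i) = prefix_sum demand i" "iarr s ''P'' (int i + 1) = prefix_sum demand (Suc i)"
    using ready_prefix_sum[OF \<open>ready s\<close>] assms by auto
  show ?thesis
    unfolding single_step_def wp_Seq wp_IAssign
    apply (rule wp_compute_overlap)
    using assms P
    apply (simp add: push_def finish_line_def)
    apply (intro conjI)
     apply (simp add: ready_def)
    apply (rule written_snoc[OF \<open>written ps s\<close>])
    apply (auto simp: ready_def wrap_freq_def less_Suc_eq)
    done
qed

text \<open>Each inner round costs 1 + 3 + 120 = 124; the constant 126 is 2 for resetting
  \<open>j\<close>, 4 for the failing test and 120 for the single line.\<close>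

lemma row_step:
  assumes "i < m" "ready s" "written (pair_list i) s" "ivar s ''i'' = int i"
  shows "wp row_step (\<lambda>t s'. t \<le> 124 * m + 126 \<and> ready s' \<and> written (pair_list (Suc i)) s' \<and>
    ivar s' ''i'' = int (Suc i)) s"
proof -
  define Inv where "Inv k s \<longleftrightarrow> ready s \<and> written (pair_list i @ map (Pair i) [0..<k]) s \<and>
    ivar s ''i'' = int i \<and> ivar s ''j'' = int k" for k s
  have "wp (While (ILess (IVar ''j'') (IVar ''i'')) pair_step)
     (\<lambda>t s'. t \<le> i * (1 + btime (ILess (IVar ''j'') (IVar ''i'')) + 120)
        + (1 + btime (ILess (IVar ''j'') (IVar ''i''))) \<and> Inv i s')
     (s\<lparr>ivar := (ivar s)(''j'' := 0)\<rparr>)"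
  proof (rule wp_While)
    show "Inv 0 (s\<lparr>ivar := (ivar s)(''j'' := 0)\<rparr>)"
      using assms by (simp add: Inv_def ready_def written_def)
  next
    fix k s assume "k < i" "Inv k s"
    then show "bval (ILess (IVar ''j'') (IVar ''i'')) s \<and> wp pair_step (\<lambda>t s'. t \<le> 120 \<and> Inv (Suc k) s') s"
      using pair_step[OF \<open>i < m\<close>, of k s "pair_list i @ map (Pair i) [0..<k]"] by (simp add: Inv_def)
  qed (simp add: Inv_def)
  then show ?thesis
    unfolding row_step_def wp_Seq wp_IAssign ival.simps
  proof (rule wp_mono)
    fix t s'
    assume t: "t \<le> i * (1 + btime (ILess (IVar ''j'') (IVar ''i'')) + 120)
        + (1 + btime (ILess (IVar ''j'') (IVar ''i''))) \<and> Inv i s'"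
    have "wp single_step (\<lambda>t s'. t \<le> 120 \<and> ready s' \<and>
        written ((pair_list i @ map (Pair i) [0..<i]) @ [(i, i)]) s' \<and> ivar s' ''i'' = int (Suc i)) s'"
      using t assms by (intro single_step) (auto simp: Inv_def)
    then show "wp single_step (\<lambda>t2 s'. 1 + itime (IConst 0) + (t + t2) \<le> 124 * m + 126 \<and>
        ready s' \<and> written (pair_list (Suc i)) s' \<and> ivar s' ''i'' = int (Suc i)) s'"
      by (rule wp_mono) (use t \<open>i < m\<close> in \<open>auto simp: pair_list_Suc\<close>)
  qed
qed

text \<open>Mirrors the branches of \<open>find_centre\<close> as a condition on the input, which
  keeps the combinatorics of the edge list out of the program verification.\<close>

definition centre_found :: "state \<Rightarrow> bool" where
  "centre_found s \<longleftrightarrow> int z =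
     (if iarr s ''edge_fst'' 0 = iarr s ''edge_fst'' 1 \<or> iarr s ''edge_fst'' 0 = iarr s ''edge_snd'' 1
      then iarr s ''edge_fst'' 0 else iarr s ''edge_snd'' 0)"

lemma scan_init:
  assumes "input s" "0 < m \<Longrightarrow> centre_found s"
  shows "wp scan_init (\<lambda>t s'. t \<le> 60 \<and> scan_inv 0 s') s"
  using assms
  by (auto simp: scan_init_def find_centre_def centre_found_def scan_inv_def input_def prefix_sum_def)

lemma compute_trips:
  assumes "scan_inv m s"
  shows "wp compute_trips (\<lambda>t s'. t \<le> 20 \<and> ready s') s"
  using assms
  by (auto simp: compute_trips_def scan_inv_def input_def ready_def num_trips_def)

lemma emit_init:
  assumes "ready s"
  shows "wp emit_init (\<lambda>t s'. t \<le> 20 \<and> ready s' \<and> written (pair_list 0) s' \<and> ivar s' ''i'' = 0) s"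
  using assms
  by (auto simp: emit_init_def ready_def written_def pair_list_def)

lemma ready_num_lines: "ready (s\<lparr>ivar := (ivar s)(''num_lines'' := x)\<rparr>) = ready s"
  by (simp add: ready_def)

lemma written_num_lines: "written ps (s\<lparr>ivar := (ivar s)(''num_lines'' := x)\<rparr>) = written ps s"
  by (simp add: written_def)

text \<open>\<open>m\<close> rows of linear cost give a quadratic bound; the factor 1000 is
  generous.\<close>

lemma star_program:
  assumes "input s" "0 < m \<Longrightarrow> centre_found s"
  shows "wp star_program (\<lambda>t s'. t \<le> 1000 * (m + 1) ^ 2 \<and> ready s' \<and> written (pair_list m) s' \<and>
    ivar s' ''num_lines'' = ivar s' ''q'') s"
proof -
  let ?b = "ILess (IVar ''i'') (IVar ''m'')"
  define Inv where "Inv k s \<longleftrightarrow> ready s \<and> written (pair_list k) s \<and> ivar s ''i'' = int k" for k s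
  have loop1: "wp (While ?b scan_step) (\<lambda>t s'. t \<le> m * (1 + btime ?b + 60) + (1 + btime ?b) \<and> scan_inv m s') s"
    if "scan_inv 0 s" for s
    using that by (rule wp_While) (auto simp: scan_step, auto simp: scan_inv_def input_def)
  have loop2: "wp (While ?b row_step)
      (\<lambda>t s'. t \<le> m * (1 + btime ?b + (124 * m + 126)) + (1 + btime ?b) \<and> Inv m s') s"
    if "Inv 0 s" for s
    using that
  proof (rule wp_While)
    fix k s assume "k < m" "Inv k s"
    then show "bval ?b s \<and> wp row_step (\<lambda>t s'. t \<le> 124 * m + 126 \<and> Inv (Suc k) s') s"
      using row_step[of k s] by (simp add: Inv_def ready_def)
  qed (simp add: Inv_def ready_def)
  show ?thesis
    unfolding star_program_def wp_Seq
    apply (rule wp_mono[OF scan_init[OF assms]], assumption, elim conjE)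
    apply (rule wp_mono[OF loop1], assumption, elim conjE)
    apply (rule wp_mono[OF compute_trips], assumption, elim conjE)
    apply (rule wp_mono[OF emit_init], assumption, elim conjE)
    apply (rule wp_mono[OF loop2], simp add: Inv_def, elim conjE)
    apply (simp add: Inv_def ready_num_lines written_num_lines power2_eq_square algebra_simps)
    done
qed

lemma written_encodes_concept:
  assumes w: "written (pair_list m) s" and n: "ivar s ''num_lines'' = ivar s ''q''"
  shows "encodes_concept s (wrap_concept num_trips)"
  unfolding encodes_concept_def
proof (intro exI[of _ "map pair_path (pair_list m)"] conjI allI impI ballI)
  let ?ps = "map pair_path (pair_list m)"
  show "ivar s ''num_lines'' = int (length ?ps)"
    using w n by (simp add: written_def)
  show "distinct xs" if "xs \<in> set ?ps" for xs
    using that pair_path(1) by (auto simp: set_pair_list simp del: pair_path.simps)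
  show "distinct (map line_of ?ps)"
    using inj_pair_line by (simp add: distinct_map distinct_pair_list set_pair_list comp_def)
  show "fst (wrap_concept num_trips) = line_of ` set ?ps"
    by (simp add: wrap_concept_def pair_lines_def set_pair_list image_image)
  fix i assume "i < length ?ps"
  then have i: "i < length (pair_list m)" by simp
  obtain a b where ab: "pair_list m ! i = (a, b)" by force
  with i have "(a, b) \<in> index_pairs m"
    by (metis nth_mem set_pair_list)
  then show "iarr s ''frequency'' (int i) = int (snd (wrap_concept num_trips) (line_of (?ps ! i)))"
    using w i by (simp add: written_def ab wrap_concept_freq wrap_freq_nonneg del: pair_path.simps)
  \<comment> \<open>Needed at both \<open>i\<close> and \<open>Suc i\<close>, hence up to and
    including the number of lines.\<close>
  have off: "iarr s ''offset'' (int k) = int (length (concat (take k ?ps)))" if "k \<le> length ?ps" for k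
    using w that by (simp add: written_def take_map)
  show "iarr s ''offset'' (int i + 1) = iarr s ''offset'' (int i) + int (length (?ps ! i))"
    using off[of "Suc i"] off[of i] i
    by (simp add: take_Suc_conv_app_nth add.commute del: pair_path.simps)
  fix k assume "k < length (?ps ! i)"
  note ct = concat_take_nth[OF \<open>i < length ?ps\<close> this]
  have "iarr s ''path'' (int (length (concat (take i ?ps)) + k)) = int (?ps ! i ! k)"
    using w ct(1) unfolding written_def ct(2)[symmetric] by blast
  then show "iarr s ''path'' (iarr s ''offset'' (int i) + int k) = int (?ps ! i ! k)"
    using off[of i] \<open>i < length ?ps\<close> by (simp only: less_imp_le of_nat_add)
qed

lemma solves:
  assumes "input s" "0 < m \<Longrightarrow> centre_found s"
  shows "\<exists>t s'. exec star_program s t s' \<and> t \<le> 1000 * (m + 1) ^ 2 \<and> output_correct I s'"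
proof -
  have "wp star_program (\<lambda>t s'. t \<le> 1000 * (m + 1) ^ 2 \<and> output_correct I s') s"
    using star_program[OF assms]
  proof (rule wp_mono)
    fix t s'
    assume s': "t \<le> 1000 * (m + 1) ^ 2 \<and> ready s' \<and> written (pair_list m) s' \<and>
      ivar s' ''num_lines'' = ivar s' ''q''"
    then have "ivar s' ''feasible'' = (if \<forall>j<m. upper_nonneg j then 1 else 0)"
      by (simp add: ready_def)
    moreover have "encodes_concept s' (wrap_concept num_trips)"
      using s' by (blast intro: written_encodes_concept)
    ultimately show "t \<le> 1000 * (m + 1) ^ 2 \<and> output_correct I s'"
      using s' wrap_concept_optimal unfolding output_correct_def feasible_iff by (auto simp del: split_paired_Ex)
  qed
  then show ?thesis by (simp add: wp_def)
qed

end

section \<open>Recovering the star from the encoded edge list\<close>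

lemma star_centre:
  fixes es :: "(nat \<times> nat) list" and fs sn :: "int \<Rightarrow> int"
  assumes star: "is_star V E"
    and es: "distinct (map (\<lambda>(a, b). {a, b}) es)" "E = (\<lambda>(a, b). {a, b}) ` set es"
    and fs: "\<And>j. j < length es \<Longrightarrow> fs (int j) = int (fst (es ! j)) \<and> sn (int j) = int (snd (es ! j))"
  obtains z B where "finite B" "V = insert z B" "z \<notin> B" "E = {{z, b} |b. b \<in> B}"
    "0 < length es \<Longrightarrow> int z = (if fs 0 = fs 1 \<or> fs 0 = sn 1 then fs 0 else sn 0)"
proof -
  from star obtain A B where AB: "finite B" "card A = 1" "A \<inter> B = {}" "V = A \<union> B"
    "E = {{a, b} |a b. a \<in> A \<and> b \<in> B}"
    by (auto simp: is_star_def complete_bipartite_def)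
  then obtain z where z: "A = {z}" by (auto simp: card_1_singleton_iff)
  then have B: "V = insert z B" "z \<notin> B" "E = {{z, b} |b. b \<in> B}"
    using AB by auto
  define p q where "p = fst (es ! 0)" and "q = snd (es ! 0)"
  define c where "c = (if fs 0 = fs 1 \<or> fs 0 = sn 1 then p else q)"
  have c: "int c = (if fs 0 = fs 1 \<or> fs 0 = sn 1 then fs 0 else sn 0)" if "0 < length es"
    using fs[OF that] by (simp add: c_def p_def q_def)
  have mem: "{fst (es ! j), snd (es ! j)} \<in> E" if "j < length es" for j
    using that unfolding es(2) by (auto simp: case_prod_beta intro!: rev_image_eqI[OF nth_mem])
  then have zmem: "z \<in> {fst (es ! j), snd (es ! j)}" if "j < length es" for j
    using that unfolding B by blast
  \<comment> \<open>A star with one edge has two possible centres, so the centre is fixed only now,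
    in agreement with the program's choice \<open>c\<close>.\<close>
  consider "length es = 0" | "length es = 1" | "length es \<ge> 2" by linarith
  then show ?thesis
  proof cases
    case 1
    then show ?thesis using that[OF AB(1) B] by simp
  next
    case 2
    then have E: "E = {{p, q}}"
      unfolding es(2) p_def q_def by (cases es) (auto simp: case_prod_beta)
    then have "{p, q} \<in> {{z, b} |b. b \<in> B}" using B(3) by simp
    then obtain b where b: "b \<in> B" "{p, q} = {z, b}" by blast
    have "b' = b" if "b' \<in> B" for b'
    proof -
      have "{z, b'} \<in> E" using that B by blast
      then show ?thesis using E b by (auto simp: doubleton_eq_iff)
    qed
    then have Bb: "B = {b}" using b(1) by blast
    have "c = z \<or> c = b" using b(2) by (auto simp: c_def doubleton_eq_iff)
    then show ?thesis
    proof
      assume "c = z"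
      then show ?thesis using that[OF AB(1) B] c by simp
    next
      \<comment> \<open>The program chose the other endpoint: centre and leaf exchange their
        roles.\<close>
      assume "c = b"
      then show ?thesis
        using that[of "{z}" b] B Bb c by (auto simp: insert_commute)
    qed
  next
    case 3
    then have len: "0 < length es" "1 < length es" by auto
    \<comment> \<open>Two distinct edges share only the centre, so \<open>p\<close> is the centre
      exactly if it occurs in the second edge.\<close>
    have "{p, q} \<noteq> {fst (es ! 1), snd (es ! 1)}"
      using nth_eq_iff_index_eq[OF es(1), of 0 1] len by (auto simp: case_prod_beta p_def q_def)
    moreover have "z \<in> {p, q}" "z \<in> {fst (es ! 1), snd (es ! 1)}"
      using zmem[OF len(1)] zmem[OF len(2)] by (simp_all add: p_def q_def)
    moreover have "fs 0 = int p" "fs 1 = int (fst (es ! 1))" "sn 1 = int (snd (es ! 1))"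
      using fs[OF len(1)] fs[OF len(2)] by (simp_all add: p_def)
    ultimately have "z = c" by (auto simp: c_def)
    then show ?thesis using that[OF AB(1) B] c by simp
  qed
qed

lemma star_program_solves:
  assumes valid: "valid_instance I" and d: "d_fix I = 0"
    and star: "is_star (verts I) (edges I)" and enc: "encodes_instance s I"
  shows "\<exists>t s'. exec star_program s t s' \<and> t \<le> 1000 * (card (verts I) + 1) ^ 2 \<and> output_correct I s'"
proof -
  from enc obtain es where
    es: "distinct (map (\<lambda>(a, b). {a, b}) es)" "edges I = (\<lambda>(a, b). {a, b}) ` set es"
    and mem: "\<forall>j<length es. \<forall>a b e. es ! j = (a, b) \<and> e = {a, b} \<longrightarrow>
           iarr s ''edge_fst'' (int j) = int a \<and>
           iarr s ''edge_snd'' (int j) = int b \<and>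
           rarr s ''cost'' (int j) = edge_cost I e \<and>
           iarr s ''f_min'' (int j) = f_min I e \<and>
           (case f_max I e of
              None \<Rightarrow> iarr s ''f_max_infinite'' (int j) = 1
            | Some u \<Rightarrow> iarr s ''f_max_infinite'' (int j) = 0 \<and>
                        iarr s ''f_max'' (int j) = u)"
    and m: "ivar s ''m'' = int (card (edges I))"
    unfolding encodes_instance_def by (elim conjE exE)
  have card_edges: "card (edges I) = length es"
    using es distinct_card[OF es(1)] by simp
  define m where "m = length es"
  have fs: "iarr s ''edge_fst'' (int j) = int (fst (es ! j)) \<and> iarr s ''edge_snd'' (int j) = int (snd (es ! j))"
    if "j < length es" for j
    using mem[rule_format, OF that, of "fst (es ! j)" "snd (es ! j)"] by simp
  obtain z B where B: "finite B" "verts I = insert z B" "z \<notin> B" "edges I = {{z, b} |b. b \<in> B}"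
    and z: "0 < length es \<Longrightarrow> int z =
     (if iarr s ''edge_fst'' 0 = iarr s ''edge_fst'' 1 \<or> iarr s ''edge_fst'' 0 = iarr s ''edge_snd'' 1
      then iarr s ''edge_fst'' 0 else iarr s ''edge_snd'' 0)"
    by (rule star_centre[OF star es, where fs = "iarr s ''edge_fst''" and sn = "iarr s ''edge_snd''"])
      (use fs in blast)+
  \<comment> \<open>The same formula as in \<open>scan_step\<close>; for j < m the subtraction on
    naturals does not truncate, because \<open>z\<close> is one of the endpoints.\<close>
  define leaf where "leaf j = fst (es ! j) + snd (es ! j) - z" for j
  have leaf: "{fst (es ! j), snd (es ! j)} = {leaf j, z}" "leaf j \<in> B"
    "fst (es ! j) + snd (es ! j) = leaf j + z" if "j < m" for j
  proof -
    have "{fst (es ! j), snd (es ! j)} \<in> edges I"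
      using that unfolding es(2) m_def by (auto simp: case_prod_beta intro!: rev_image_eqI[OF nth_mem])
    then obtain b where b: "b \<in> B" "{fst (es ! j), snd (es ! j)} = {z, b}"
      unfolding B by blast
    then show "{fst (es ! j), snd (es ! j)} = {leaf j, z}" "leaf j \<in> B"
      "fst (es ! j) + snd (es ! j) = leaf j + z"
      by (auto simp: leaf_def doubleton_eq_iff)
  qed
  have edges: "edges I = (\<lambda>j. {leaf j, z}) ` {..<m}"
  proof -
    have "set es = (!) es ` {..<m}"
      by (auto simp: set_conv_nth m_def)
    then have "edges I = (\<lambda>j. {fst (es ! j), snd (es ! j)}) ` {..<m}"
      by (simp add: es(2) image_image case_prod_beta)
    also have "\<dots> = (\<lambda>j. {leaf j, z}) ` {..<m}"
      by (rule image_cong) (simp_all add: leaf(1))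
    finally show ?thesis .
  qed
  have inj: "inj_on leaf {..<m}"
  proof (rule inj_onI)
    fix i j assume ij: "i \<in> {..<m}" "j \<in> {..<m}" "leaf i = leaf j"
    then have "map (\<lambda>(a, b). {a, b}) es ! i = map (\<lambda>(a, b). {a, b}) es ! j"
      using leaf(1) by (simp add: case_prod_beta m_def)
    then show "i = j"
      using nth_eq_iff_index_eq[OF es(1)] ij by (simp add: m_def)
  qed
  have "B \<subseteq> leaf ` {..<m}"
  proof
    fix b assume "b \<in> B"
    then have "{z, b} \<in> (\<lambda>j. {leaf j, z}) ` {..<m}" using B(4) edges by blast
    then show "b \<in> leaf ` {..<m}" by (auto simp: doubleton_eq_iff)
  qed
  then have B_eq: "B = leaf ` {..<m}" using leaf(2) by blast
  interpret nat_star_instance I m z leaf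
    by unfold_locales (use valid d B(2,3) edges inj B_eq in auto)
  have "input s"
    unfolding input_def
  proof (intro conjI allI impI)
    show "ivar s ''m'' = int m" using m card_edges by (simp add: m_def)
    fix j assume j: "j < m"
    then have len: "j < length es" by (simp add: m_def)
    have *: "es ! j = (fst (es ! j), snd (es ! j)) \<and> spoke j = {fst (es ! j), snd (es ! j)}"
      using leaf(1)[OF j] by (simp add: spoke_def)
    show "iarr s ''edge_fst'' (int j) + iarr s ''edge_snd'' (int j) = int (leaf j) + int z"
      using fs[OF len] leaf(3)[OF j] by (simp flip: of_nat_add)
    show "iarr s ''f_min'' (int j) = f_min I (spoke j)"
      "(iarr s ''f_max_infinite'' (int j) < 1 \<and> iarr s ''f_max'' (int j) < 0) = (\<not> upper_nonneg j)"
      using mem[rule_format, OF len *] by (auto simp: upper_nonneg_def le_upper_def split: option.splits)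
  qed
  moreover have "centre_found s" if "0 < m"
    using z that by (simp add: centre_found_def m_def)
  ultimately obtain t s' where "exec star_program s t s'" "t \<le> 1000 * (m + 1) ^ 2" "output_correct I s'"
    using solves by blast
  moreover have "m \<le> card (verts I)"
    unfolding verts_eq using inj z_notin by (simp add: card_image)
  then have "1000 * (m + 1) ^ 2 \<le> 1000 * (card (verts I) + 1) ^ 2"
    by (intro mult_left_mono power_mono) auto
  ultimately show ?thesis by (meson order_trans)
qed

theorem theorem10:
  "\<exists>(P :: com) (T :: nat \<Rightarrow> nat).
     (\<lambda>n. real (T n)) \<in> O(\<lambda>n. real n ^ 3) \<and>
     (\<forall>I :: nat lp_instance.
        valid_instance I \<and> d_fix I = 0 \<and> is_star (verts I) (edges I) \<longrightarrow>
        solves_within P I (T (card (verts I))))"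
proof (intro exI[of _ star_program] exI[of _ "\<lambda>n. 1000 * (n + 1) ^ 2"] conjI allI impI)
  show "(\<lambda>n. real (1000 * (n + 1) ^ 2)) \<in> O(\<lambda>n. real n ^ 3)"
  \<comment> \<open>For n >= 1, n + 1 <= 2 * n, so the square is at most 4 * n^2 <= 4 * n^3; hence
    4000.\<close>
  proof (rule bigoI[where c = 4000], rule eventually_sequentiallyI[of 1])
    fix n :: nat assume "1 \<le> n"
    then have "(n + 1) ^ 2 \<le> (2 * n) ^ 2" by (intro power_mono) auto
    also have "\<dots> \<le> 4 * n ^ 3"
      using \<open>1 \<le> n\<close> by (simp add: power2_eq_square power3_eq_cube)
    finally have "real (1000 * (n + 1) ^ 2) \<le> real (4000 * n ^ 3)"
      by (subst of_nat_le_iff) linarith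
    then show "norm (real (1000 * (n + 1) ^ 2)) \<le> 4000 * norm (real n ^ 3)"
      by simp
  qed
qed (unfold solves_within_def, blast intro: star_program_solves)

end
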